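(* Let $P$ and $Q$ be finite partially ordered sets, each with a minimum element. Then $\mathbf{MH}_{P,Q}=\mathbf{HH}_{P,Q}$ (as classes of countably infinite $P,Q$-colored graphs) if and only if $Q$ is a linear order.
   Context: Let $P$ and $Q$ be finite partially ordered sets (taken to be disjoint as sets of colors: $P$ for vertices, $Q$ for edges), each having a minimum element denoted $\mathbb 0$ (corresponding to uncolored vertices and to nonedges, respectively). A $P,Q$-colored graph is a tuple $(V,P,Q,\chi,\xi)$ where $V$ is a (nonempty) vertex set, $\chi:V\to P$ is an arbitrary function, and $\xi:V^2\to Q$ is a symmetric function with $\xi(v,v)=\mathbb 0$ for all $v\in V$. An induced substructure is obtained by restricting $\chi$ and $\xi$ to a subset of $V$. A homomorphism from $(G,P,Q,\chi,\xi)$ to $(H,P,Q,\chi',\xi')$ is a function $f:G\to H$ such that $\chi(v)\leq_P\chi'(f(v))$ for all $v\in G$ and $\xi(x,y)\leq_Q\xi'(f(x),f(y))$ for all $x,y\in G$. A monomorphism is an injective homomorphism (it need not be an embedding). An endomorphism of $G$ is a homomorphism $G\to G$. $\mathbf{HH}_{P,Q}$ is the class of $P,Q$-colored graphs $G$ such that every homomorphism from a finite induced substructure of $G$ into $G$ extends to an endomorphism of $G$. $\mathbf{MH}_{P,Q}$ is the class of $P,Q$-colored graphs $G$ such that every monomorphism from a finite induced substructure of $G$ into $G$ extends to an endomorphism of $G$. Only countably infinite structures are considered. *)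

theory Defs
  imports Main "HOL-Library.Countable_Set"
begin

text \<open>
  The color posets are types of sort \<open>{finite, order_bot}\<close>; \<open>bot\<close> is the color of uncolored
  vertices and of nonedges. The coloring functions are total on the vertex type; only their
  values on \<open>verts\<close> matter in the definitions below.
\<close>

record ('v, 'p, 'q) pq_structure =
  verts :: "'v set"
  vcol :: "'v \<Rightarrow> 'p"
  ecol :: "'v \<Rightarrow> 'v \<Rightarrow> 'q"

definition pq_graph :: "('v, 'p, 'q::order_bot) pq_structure \<Rightarrow> bool" where
  "pq_graph G \<longleftrightarrow> verts G \<noteq> {} \<and>
     (\<forall>x\<in>verts G. \<forall>y\<in>verts G. ecol G x y = ecol G y x) \<and>
     (\<forall>x\<in>verts G. ecol G x x = bot)"

definition induced :: "('v, 'p, 'q) pq_structure \<Rightarrow> 'v set \<Rightarrow> ('v, 'p, 'q) pq_structure" where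
  "induced G A = G\<lparr>verts := A\<rparr>"

definition homomorphism ::
  "('v, 'p::order, 'q::order) pq_structure \<Rightarrow> ('w, 'p, 'q) pq_structure \<Rightarrow> ('v \<Rightarrow> 'w) \<Rightarrow> bool" where
  "homomorphism G H f \<longleftrightarrow> f ` verts G \<subseteq> verts H \<and>
     (\<forall>x\<in>verts G. vcol G x \<le> vcol H (f x)) \<and>
     (\<forall>x\<in>verts G. \<forall>y\<in>verts G. ecol G x y \<le> ecol H (f x) (f y))"

definition monomorphism ::
  "('v, 'p::order, 'q::order) pq_structure \<Rightarrow> ('w, 'p, 'q) pq_structure \<Rightarrow> ('v \<Rightarrow> 'w) \<Rightarrow> bool" where
  "monomorphism G H f \<longleftrightarrow> homomorphism G H f \<and> inj_on f (verts G)"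

definition endomorphism :: "('v, 'p::order, 'q::order) pq_structure \<Rightarrow> ('v \<Rightarrow> 'v) \<Rightarrow> bool" where
  "endomorphism G f \<longleftrightarrow> homomorphism G G f"

definition HH :: "('v, 'p::{finite, order_bot}, 'q::{finite, order_bot}) pq_structure set" where
  "HH = {G. pq_graph G \<and>
     (\<forall>A f. A \<subseteq> verts G \<and> A \<noteq> {} \<and> finite A \<and> homomorphism (induced G A) G f \<longrightarrow>
        (\<exists>g. endomorphism G g \<and> (\<forall>x\<in>A. g x = f x)))}"

definition MH :: "('v, 'p::{finite, order_bot}, 'q::{finite, order_bot}) pq_structure set" where
  "MH = {G. pq_graph G \<and>
     (\<forall>A f. A \<subseteq> verts G \<and> A \<noteq> {} \<and> finite A \<and> monomorphism (induced G A) G f \<longrightarrow>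
        (\<exists>g. endomorphism G g \<and> (\<forall>x\<in>A. g x = f x)))}"

definition countably_infinite :: "('v, 'p, 'q) pq_structure set" where
  "countably_infinite = {G. countable (verts G) \<and> infinite (verts G)}"

end

theory Submission
  imports Defs "HOL-Library.Nat_Bijection"
begin

text \<open>
  The inclusion of \<open>HH\<close> in \<open>MH\<close> is immediate.  Everything else rests on the fact that, over a
  countable vertex set, a partial map extends to an endomorphism as soon as it can be extended
  one vertex at a time (\<open>endomorphism_by_one_point_extensions\<close>).

  If the edge colors are linearly ordered, let \<open>f\<close> be a homomorphism on a finite set \<open>A\<close> of an
  \<open>MH\<close>-graph and \<open>x\<close> a new vertex.  In every fibre of \<open>f\<close> choose a vertex whose edge to \<open>x\<close> has
  the largest color in that fibre.  On the set of chosen vertices \<open>f\<close> is injective, so it extends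
  to an endomorphism \<open>g\<close>; by the choice, \<open>g x\<close> is a correct image of \<open>x\<close> for the whole of \<open>f\<close>
  (\<open>MH_one_point_extension\<close>).  Hence the graph is in \<open>HH\<close>.

  If \<open>a\<close> and \<open>b\<close> are incomparable edge colors, take a countable graph with edge colors
  \<open>a\<close>, \<open>b\<close>, in the style of the Rado graph, and delete a single edge.  Any finite set of vertices
  has a common neighbor with prescribed colors from \<open>{a, b}\<close> (\<open>two_color_extension\<close>), so that
  monomorphisms extend by one point and remain injective.  The two ends of the missing edge, however,
  have a neighbor joined to one by \<open>a\<close> and to the other by \<open>b\<close>; the homomorphism identifying
  the two ends cannot be extended to it, as no color of the graph lies above both \<open>a\<close> and \<open>b\<close>.
\<close>

section \<open>Extending partial maps one vertex at a time\<close>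

text \<open>
  The predicate \<open>\<Phi>\<close> is the property of partial maps that is kept along the construction: being
  a homomorphism in one application, being a monomorphism in the other.
\<close>

lemma endomorphism_by_one_point_extensions:
  fixes G :: "('v, 'p::order, 'q::order) pq_structure"
    and \<Phi> :: "'v set \<Rightarrow> ('v \<Rightarrow> 'v) \<Rightarrow> bool"
  assumes "countable (verts G)"
    and hom: "\<And>A f. \<Phi> A f \<Longrightarrow> homomorphism (induced G A) G f"
    and ext: "\<And>A f x. \<lbrakk>finite A; A \<noteq> {}; A \<subseteq> verts G; \<Phi> A f; x \<in> verts G; x \<notin> A\<rbrakk>
                \<Longrightarrow> \<exists>y. \<Phi> (insert x A) (f(x := y))"
    and A: "finite A" "A \<noteq> {}" "A \<subseteq> verts G" and "\<Phi> A f"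
  obtains g where "endomorphism G g" and "\<And>x. x \<in> A \<Longrightarrow> g x = f x"
proof -
  define e where "e = from_nat_into (verts G)"
  have "verts G \<noteq> {}" using A by auto
  then have e: "range e = verts G"
    using \<open>countable (verts G)\<close> unfolding e_def by simp
  \<comment> \<open>After \<open>n\<close> steps the map \<open>F n\<close> satisfies \<open>\<Phi>\<close> on \<open>D n\<close>, and later maps agree with it there.\<close>
  define D where "D n = A \<union> e ` {..<n}" for n
  have D_Suc: "D (Suc n) = insert (e n) (D n)" for n
    by (auto simp: D_def lessThan_Suc)
  have D_fin: "finite (D n)" and D_ne: "D n \<noteq> {}" and D_V: "D n \<subseteq> verts G" for n
    using A e by (auto simp: D_def)
  have e_V: "e n \<in> verts G" for n using e by auto
  define F where "F = rec_nat f (\<lambda>n h. if e n \<in> D n then h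
      else h(e n := SOME y. \<Phi> (insert (e n) (D n)) (h(e n := y))))"
  have F_0: "F 0 = f" by (simp add: F_def)
  have F_Suc: "F (Suc n) = (if e n \<in> D n then F n
      else (F n)(e n := SOME y. \<Phi> (insert (e n) (D n)) ((F n)(e n := y))))" for n
    by (simp add: F_def)
  have \<Phi>: "\<Phi> (D n) (F n)" for n
  proof (induction n)
    case 0
    show ?case using \<open>\<Phi> A f\<close> by (simp add: D_def F_0)
  next
    case (Suc n)
    show ?case
    proof (cases "e n \<in> D n")
      case True
      then show ?thesis using Suc by (simp add: F_Suc D_Suc insert_absorb)
    next
      case False
      from ext[OF D_fin D_ne D_V Suc e_V False]
      have "\<Phi> (insert (e n) (D n))
              ((F n)(e n := SOME y. \<Phi> (insert (e n) (D n)) ((F n)(e n := y))))"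
        by (rule someI_ex)
      then show ?thesis using False by (simp only: F_Suc D_Suc if_False)
    qed
  qed
  have stable: "F m x = F n x" if "x \<in> D n" "n \<le> m" for x m n
    using that(2)
  proof (induction m rule: dec_induct)
    case base
    show ?case by simp
  next
    case (step m)
    have "x \<in> D m" using that(1) step.hyps by (auto simp: D_def)
    then show ?case using step.IH by (auto simp: F_Suc)
  qed
  have ex: "\<exists>n. x \<in> D n" if x: "x \<in> verts G" for x
  proof -
    obtain n where "x = e n" using x unfolding e[symmetric] by (rule rangeE)
    then have "x \<in> D (Suc n)" by (simp add: D_Suc)
    then show ?thesis ..
  qed
  define g where "g x = F (LEAST n. x \<in> D n) x" for x
  have g: "g x = F n x" if "x \<in> D n" for x n
    unfolding g_def using LeastI[of "\<lambda>n. x \<in> D n", OF that] Least_le[of "\<lambda>n. x \<in> D n", OF that]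
    by (metis stable)
  have common: "\<exists>n. x \<in> D n \<and> y \<in> D n" if "x \<in> verts G" "y \<in> verts G" for x y
  proof -
    obtain i j where "x \<in> D i" "y \<in> D j" using ex \<open>x \<in> verts G\<close> \<open>y \<in> verts G\<close> by blast
    then have "x \<in> D (max i j)" "y \<in> D (max i j)" by (auto simp: D_def less_max_iff_disj)
    then show ?thesis by blast
  qed
  have F_hom: "homomorphism (induced G (D n)) G (F n)" for n
    using hom \<Phi> .
  have "g x \<in> verts G \<and> vcol G x \<le> vcol G (g x)" if x: "x \<in> verts G" for x
  proof -
    obtain n where n: "x \<in> D n" using ex x by blast
    then show ?thesis using F_hom[of n] by (auto simp: homomorphism_def induced_def g)
  qed
  moreover have "ecol G x y \<le> ecol G (g x) (g y)" if xy: "x \<in> verts G" "y \<in> verts G" for x y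
  proof -
    obtain n where n: "x \<in> D n" "y \<in> D n" using common xy by blast
    then show ?thesis using F_hom[of n] by (auto simp: homomorphism_def induced_def g)
  qed
  ultimately have "endomorphism G g"
    by (auto simp: endomorphism_def homomorphism_def)
  moreover have "g x = f x" if "x \<in> A" for x
    using g[of x 0] that by (simp add: D_def F_0)
  ultimately show thesis using that by blast
qed

lemma homomorphism_induced_subset:
  assumes "homomorphism (induced G A) H f" and "S \<subseteq> A"
  shows "homomorphism (induced G S) H f"
  using assms by (auto simp: homomorphism_def induced_def subset_iff)

lemma homomorphism_induced_insert:
  fixes G :: "('v, 'p::order, 'q::order_bot) pq_structure"
  assumes G: "pq_graph G" and A: "A \<subseteq> verts G" and x: "x \<in> verts G" "x \<notin> A"
    and f: "homomorphism (induced G A) G f"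
    and y: "y \<in> verts G" "vcol G x \<le> vcol G y"
    and edges: "\<And>z. z \<in> A \<Longrightarrow> ecol G x z \<le> ecol G y (f z)"
  shows "homomorphism (induced G (insert x A)) G (f(x := y))"
proof -
  have sym: "ecol G u v = ecol G v u" if "u \<in> verts G" "v \<in> verts G" for u v
    using G that by (auto simp: pq_graph_def)
  have loop: "ecol G x x \<le> ecol G y y" using G x by (simp add: pq_graph_def)
  have fA: "f z \<in> verts G" if "z \<in> A" for z
    using f that by (auto simp: homomorphism_def induced_def)
  have edges': "ecol G z x \<le> ecol G (f z) y" if "z \<in> A" for z
    using edges[OF that] sym[of z x] sym[of "f z" y] A x y fA[OF that] that by auto
  show ?thesis
    using f x y loop edges edges' by (auto simp: homomorphism_def induced_def)
qed

section \<open>Linearly ordered edge colors\<close>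

lemma HH_subset_MH: "HH \<subseteq> MH"
  by (auto simp: HH_def MH_def monomorphism_def)

lemma MH_one_point_extension:
  fixes G :: "('v, 'p::{finite, order_bot}, 'q::{finite, order_bot}) pq_structure"
  assumes linear: "\<And>c d :: 'q. c \<le> d \<or> d \<le> c"
    and "G \<in> MH" and A: "finite A" "A \<noteq> {}" "A \<subseteq> verts G"
    and f: "homomorphism (induced G A) G f" and x: "x \<in> verts G" "x \<notin> A"
  shows "\<exists>y. homomorphism (induced G (insert x A)) G (f(x := y))"
proof -
  have G: "pq_graph G" using \<open>G \<in> MH\<close> by (simp add: MH_def)
  have "\<exists>s\<in>A. f s = w \<and> (\<forall>z\<in>A. f z = w \<longrightarrow> ecol G x z \<le> ecol G x s)" if w: "w \<in> f ` A" for w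
  proof -
    let ?C = "ecol G x ` {z \<in> A. f z = w}"
    have "finite ?C" "?C \<noteq> {}" using A w by auto
    then obtain m where "m \<in> ?C" "\<forall>c\<in>?C. m \<le> c \<longrightarrow> m = c"
      using finite_has_maximal by blast
    then have "m \<in> ?C" "\<forall>c\<in>?C. c \<le> m" using linear by force+
    then show ?thesis by auto
  qed
  then obtain s where s: "\<And>w. w \<in> f ` A \<Longrightarrow> s w \<in> A" "\<And>w. w \<in> f ` A \<Longrightarrow> f (s w) = w"
    and s_max: "\<And>z. z \<in> A \<Longrightarrow> ecol G x z \<le> ecol G x (s (f z))"
    by (metis imageI)
  let ?S = "s ` f ` A"
  have S: "?S \<subseteq> A" using s by auto
  have "inj_on f ?S" using s(2) by (auto intro!: inj_onI)
  then have "monomorphism (induced G ?S) G f"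
    using homomorphism_induced_subset[OF f S] by (simp add: monomorphism_def induced_def)
  moreover have "?S \<subseteq> verts G" "finite ?S" "?S \<noteq> {}" using S A by auto
  ultimately obtain g where g: "endomorphism G g" "\<forall>z\<in>?S. g z = f z"
    using \<open>G \<in> MH\<close> unfolding MH_def by blast
  have "ecol G x z \<le> ecol G (g x) (f z)" if z: "z \<in> A" for z
  proof -
    have "ecol G x z \<le> ecol G x (s (f z))" using s_max z .
    also have "\<dots> \<le> ecol G (g x) (g (s (f z)))"
      using g(1) x(1) s(1)[of "f z"] A z by (auto simp: endomorphism_def homomorphism_def)
    also have "g (s (f z)) = f z" using g(2) s(2) z by auto
    finally show ?thesis .
  qed
  moreover have "g x \<in> verts G" "vcol G x \<le> vcol G (g x)"
    using g(1) x(1) by (auto simp: endomorphism_def homomorphism_def)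
  ultimately have "homomorphism (induced G (insert x A)) G (f(x := g x))"
    using homomorphism_induced_insert[OF G A(3) x f] by blast
  then show ?thesis by blast
qed

lemma MH_subset_HH_if_linear:
  fixes G :: "('v, 'p::{finite, order_bot}, 'q::{finite, order_bot}) pq_structure"
  assumes linear: "\<And>c d :: 'q. c \<le> d \<or> d \<le> c"
    and G: "G \<in> MH" "countable (verts G)"
  shows "G \<in> HH"
proof -
  have "\<exists>g. endomorphism G g \<and> (\<forall>x\<in>A. g x = f x)"
    if A: "A \<subseteq> verts G" "A \<noteq> {}" "finite A" and f: "homomorphism (induced G A) G f" for A f
  proof (rule endomorphism_by_one_point_extensions[where \<Phi> = "\<lambda>A. homomorphism (induced G A) G",
        OF G(2) _ _ A(3,2,1) f])
    show "\<exists>y. homomorphism (induced G (insert x B)) G (h(x := y))"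
      if "finite B" "B \<noteq> {}" "B \<subseteq> verts G" "homomorphism (induced G B) G h"
        "x \<in> verts G" "x \<notin> B" for B h x
      using MH_one_point_extension[OF linear G(1) that] .
  qed auto
  then show ?thesis using G by (auto simp: HH_def MH_def)
qed

section \<open>Two incomparable edge colors\<close>

text \<open>
  The Rado graph on the natural numbers, with edges given by the binary expansion, recolored:
  its edges receive color \<open>a\<close>, its nonedges color \<open>b\<close>, and the pair \<open>{0, 1}\<close> receives color \<open>bot\<close>.
\<close>

definition two_color :: "'q::order_bot \<Rightarrow> 'q \<Rightarrow> nat \<Rightarrow> nat \<Rightarrow> 'q" where
  "two_color a b m n =
     (if m = n \<or> {m, n} = {0, 1} then bot
      else if m \<in> set_decode n \<or> n \<in> set_decode m then a else b)"

lemma two_color_sym: "two_color a b m n = two_color a b n m"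
  by (auto simp: two_color_def insert_commute)

lemma two_color_diag [simp]: "two_color a b n n = bot"
  by (simp add: two_color_def)

lemma two_color_0_1 [simp]: "two_color a b 0 1 = bot"
  by (simp add: two_color_def)

lemma two_color_cases: "two_color a b m n \<in> {bot, a, b}"
  by (simp add: two_color_def)

lemma set_decode_less:
  assumes "m \<in> set_decode n"
  shows "m < n"
proof (rule ccontr)
  assume "\<not> m < n"
  then have "n < 2 ^ m" using less_exp[of m] by linarith
  then show False using assms by (simp add: set_decode_def)
qed

lemma two_color_extension:
  assumes "finite U" and "S \<subseteq> U"
  obtains n where "n \<notin> U" and "\<And>u. u \<in> U \<Longrightarrow> two_color a b n u = (if u \<in> S then a else b)"
proof -
  \<comment> \<open>The extra element \<open>M\<close> makes the code \<open>n\<close> larger than \<open>1\<close> and than every member of \<open>U\<close>.\<close>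
  obtain M where M: "1 < M" "\<And>u. u \<in> U \<Longrightarrow> u < M"
  proof
    show "1 < Max (insert 1 U) + 1" using \<open>finite U\<close> by (simp add: less_Suc_eq_le)
    show "u < Max (insert 1 U) + 1" if "u \<in> U" for u
      using \<open>finite U\<close> that by (simp add: less_Suc_eq_le)
  qed
  define n where "n = set_encode (insert M S)"
  have dec: "set_decode n = insert M S"
    using assms finite_subset unfolding n_def by (intro set_encode_inverse) auto
  then have n: "M < n" using set_decode_less[of M n] by simp
  show thesis
  proof
    show "n \<notin> U" using M(2) n by (meson less_asym)
    show "two_color a b n u = (if u \<in> S then a else b)" if u: "u \<in> U" for u
    proof -
      have un: "u < n" "u < M" using M(2)[OF u] n by auto
      then have "n \<notin> set_decode u" using set_decode_less by (meson less_asym)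
      then show ?thesis using un n M(1) dec by (auto simp: two_color_def doubleton_eq_iff)
    qed
  qed
qed

text \<open>The copy of this graph, all vertices uncolored, along an injection \<open>e\<close> of the naturals.\<close>

definition two_color_graph ::
  "'q \<Rightarrow> 'q \<Rightarrow> (nat \<Rightarrow> 'v) \<Rightarrow> ('v, 'p::order_bot, 'q::order_bot) pq_structure" where
  "two_color_graph a b e = \<lparr>verts = range e, vcol = (\<lambda>_. bot),
     ecol = (\<lambda>x y. two_color a b (inv e x) (inv e y))\<rparr>"

lemma pq_graph_two_color_graph: "pq_graph (two_color_graph a b e)"
  unfolding pq_graph_def two_color_graph_def by (auto intro: two_color_sym)

lemma countably_infinite_two_color_graph:
  "inj e \<Longrightarrow> two_color_graph a b e \<in> countably_infinite"
  by (simp add: countably_infinite_def two_color_graph_def finite_image_iff)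

lemma two_color_graph_extension:
  fixes e :: "nat \<Rightarrow> 'v"
  assumes e: "inj e" and "finite W" "W \<subseteq> range e"
  obtains y where "y \<in> range e" "y \<notin> W"
    and "\<And>w. w \<in> W \<Longrightarrow> ecol (two_color_graph a b e) y w = (if P w then a else b)"
proof -
  define U where "U = inv e ` W"
  have "finite U" using \<open>finite W\<close> by (simp add: U_def)
  then obtain n where n: "n \<notin> U"
    "\<And>u. u \<in> U \<Longrightarrow> two_color a b n u = (if u \<in> {u \<in> U. P (e u)} then a else b)"
    using two_color_extension[of U "{u \<in> U. P (e u)}"] by blast
  show thesis
  proof
    show "e n \<in> range e" by simp
    show "e n \<notin> W" using n(1) e by (force simp: U_def)
    show "ecol (two_color_graph a b e) (e n) w = (if P w then a else b)" if w: "w \<in> W" for w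
    proof -
      have "inv e w \<in> U" "e (inv e w) = w"
        using w \<open>W \<subseteq> range e\<close> by (auto simp: U_def intro: f_inv_into_f)
      then show ?thesis using n(2)[of "inv e w"] e by (simp add: two_color_graph_def)
    qed
  qed
qed

lemma two_color_graph_in_MH:
  fixes a b :: "'q::{finite, order_bot}" and e :: "nat \<Rightarrow> 'v"
  assumes e: "inj e"
  shows "(two_color_graph a b e :: ('v, 'p::{finite, order_bot}, 'q) pq_structure) \<in> MH"
proof -
  let ?G = "two_color_graph a b e :: ('v, 'p, 'q) pq_structure"
  have V: "verts ?G = range e" by (simp add: two_color_graph_def)
  have ext: "\<exists>y. monomorphism (induced ?G (insert x A)) ?G (f(x := y))"
    if A: "finite A" "A \<noteq> {}" "A \<subseteq> verts ?G" and f: "monomorphism (induced ?G A) ?G f"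
      and x: "x \<in> verts ?G" "x \<notin> A" for A f x
  proof -
    have hom: "homomorphism (induced ?G A) ?G f" and inj: "inj_on f A"
      using f by (auto simp: monomorphism_def induced_def)
    then have fA: "f ` A \<subseteq> range e" by (simp add: homomorphism_def induced_def V)
    \<comment> \<open>A new vertex is sent to a vertex joined by \<open>a\<close> or \<open>b\<close> to the whole image: nonedges may be
      sent to edges, and the colors of the graph other than \<open>b\<close> lie below \<open>a\<close>.\<close>
    obtain y where y: "y \<in> range e" "y \<notin> f ` A"
      and col: "\<And>w. w \<in> f ` A \<Longrightarrow>
        ecol ?G y w = (if ecol ?G x (inv_into A f w) \<le> a then a else b)"
      using two_color_graph_extension[OF e _ fA, where P = "\<lambda>w. ecol ?G x (inv_into A f w) \<le> a"]
        A(1) by blast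
    have "ecol ?G x z \<le> ecol ?G y (f z)" if z: "z \<in> A" for z
    proof -
      have "ecol ?G x z \<in> {bot, a, b}"
        using two_color_cases by (simp add: two_color_graph_def)
      then show ?thesis using col[of "f z"] z inv_into_f_f[OF inj z] by auto
    qed
    moreover have "y \<in> verts ?G" "vcol ?G x \<le> vcol ?G y"
      using y(1) by (simp_all add: two_color_graph_def)
    ultimately have "homomorphism (induced ?G (insert x A)) ?G (f(x := y))"
      using homomorphism_induced_insert[OF pq_graph_two_color_graph A(3) x hom] by blast
    moreover have "inj_on (f(x := y)) (insert x A)"
      using inj y(2) x(2) by (auto simp: inj_on_fun_updI)
    ultimately have "monomorphism (induced ?G (insert x A)) ?G (f(x := y))"
      by (simp add: monomorphism_def induced_def)
    then show ?thesis ..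
  qed
  have count: "countable (verts ?G)" by (simp add: V)
  have "\<exists>g. endomorphism ?G g \<and> (\<forall>x\<in>A. g x = f x)"
    if A: "A \<subseteq> verts ?G" "A \<noteq> {}" "finite A" and f: "monomorphism (induced ?G A) ?G f" for A f
  proof (rule endomorphism_by_one_point_extensions[where \<Phi> = "\<lambda>A. monomorphism (induced ?G A) ?G",
        OF count _ ext A(3,2,1) f])
    show "homomorphism (induced ?G B) ?G h" if "monomorphism (induced ?G B) ?G h" for B h
      using that by (simp add: monomorphism_def)
  qed auto
  then show ?thesis by (auto simp: MH_def pq_graph_two_color_graph)
qed

lemma two_color_graph_notin_HH:
  fixes a b :: "'q::{finite, order_bot}" and e :: "nat \<Rightarrow> 'v"
  assumes e: "inj e" and ab: "\<not> a \<le> b" "\<not> b \<le> a"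
  shows "(two_color_graph a b e :: ('v, 'p::{finite, order_bot}, 'q) pq_structure) \<notin> HH"
proof
  let ?G = "two_color_graph a b e :: ('v, 'p, 'q) pq_structure"
  assume HH: "?G \<in> HH"
  have V: "verts ?G = range e" by (simp add: two_color_graph_def)
  let ?A = "{e 0, e 1}"
  have ne: "e 1 \<noteq> e 0" using e by (simp add: inj_eq)
  have "homomorphism (induced ?G ?A) ?G (\<lambda>_. e 0)"
    using e two_color_0_1[of a b] two_color_sym[of a b 1 0]
    by (auto simp: homomorphism_def induced_def two_color_graph_def)
  moreover have "?A \<subseteq> verts ?G" "?A \<noteq> {}" "finite ?A" by (auto simp: V)
  ultimately obtain g where g: "endomorphism ?G g" "\<forall>z\<in>?A. g z = e 0"
    using HH unfolding HH_def by blast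
  obtain x where x: "x \<in> range e"
    and col: "\<And>w. w \<in> ?A \<Longrightarrow> ecol ?G x w = (if w = e 0 then a else b)"
    by (rule two_color_graph_extension[OF e, where W = ?A and P = "\<lambda>w. w = e 0"]) auto
  have le: "ecol ?G x z \<le> ecol ?G (g x) (e 0)" if z: "z \<in> ?A" for z
  proof -
    have "ecol ?G x z \<le> ecol ?G (g x) (g z)"
      using g(1) x z by (auto simp: endomorphism_def homomorphism_def V)
    then show ?thesis using bspec[OF g(2) z] by simp
  qed
  have "a \<le> ecol ?G (g x) (e 0)" using le[of "e 0"] col[of "e 0"] by simp
  moreover have "b \<le> ecol ?G (g x) (e 0)" using le[of "e 1"] col[of "e 1"] ne by simp
  moreover have "ecol ?G (g x) (e 0) \<in> {bot, a, b}"
    using two_color_cases by (simp add: two_color_graph_def)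
  ultimately show False using ab by (auto simp: bot_unique)
qed

section \<open>The characterization\<close>

theorem theorem12:
  assumes "infinite (UNIV :: 'v set)"
  shows "(MH \<inter> countably_infinite :: ('v, 'p::{finite, order_bot}, 'q::{finite, order_bot}) pq_structure set)
           = HH \<inter> countably_infinite
         \<longleftrightarrow> class.linorder ((\<le>) :: 'q \<Rightarrow> 'q \<Rightarrow> bool) (<)"
    (is "?M = ?H \<longleftrightarrow> ?L")
proof
  assume eq: "?M = ?H"
  have "c \<le> d \<or> d \<le> c" for c d :: 'q
  proof (rule ccontr)
    assume "\<not> (c \<le> d \<or> d \<le> c)"
    then have cd: "\<not> c \<le> d" "\<not> d \<le> c" by auto
    obtain e :: "nat \<Rightarrow> 'v" where e: "inj e"
      using infinite_countable_subset[OF assms] by blast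
    have "two_color_graph c d e \<in> ?M"
      using two_color_graph_in_MH[OF e] countably_infinite_two_color_graph[OF e] by blast
    then show False using eq two_color_graph_notin_HH[OF e cd] by blast
  qed
  then show ?L by unfold_locales
next
  assume ?L
  then have linear: "c \<le> d \<or> d \<le> c" for c d :: 'q
    by (rule linorder.linear)
  show "?M = ?H"
    using HH_subset_MH MH_subset_HH_if_linear[OF linear]
    by (auto simp: countably_infinite_def)
qed

end
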